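(* Let $R$ be a prime ring, let $\psi : R \to R$ be a generalized derivation, and let $a \in R$ be an element dependent on $\psi$. Then either $a \in Z(R)$ or $\psi(x) = x$ for all $x \in R$.
   Context: Rings are associative (not assumed unital or commutative); $Z(R)$ denotes the center of $R$. A ring $R$ is prime if, for $a, b \in R$, $aRb = (0)$ implies $a = 0$ or $b = 0$. A derivation of $R$ is an additive mapping $d : R \to R$ with $d(xy) = d(x)y + x d(y)$ for all $x, y \in R$. An additive mapping $\psi : R \to R$ is a generalized derivation if there exists a derivation $d$ of $R$ such that $\psi(xy) = \psi(x)y + x d(y)$ for all $x, y \in R$. An element $a \in R$ is called a dependent element of a mapping $T : R \to R$ (or an element dependent on $T$) if $T(x)a = ax$ for all $x \in R$. *)

theory Defs
  imports Complex_Main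
begin

text \<open>
  The type class \<open>ring\<close> is that of associative rings, neither unital nor commutative;
  the ring \<open>R\<close> is the whole type. The zero ring counts as prime.
\<close>

class prime_ring = ring +
  assumes prime_ring: "(\<And>r. a * r * b = 0) \<Longrightarrow> a = 0 \<or> b = 0"

definition ring_center :: "'a::ring set" where
  "ring_center = {z. \<forall>x. z * x = x * z}"

definition derivation :: "('a::ring \<Rightarrow> 'a) \<Rightarrow> bool" where
  "derivation d \<longleftrightarrow> additive d \<and> (\<forall>x y. d (x * y) = d x * y + x * d y)"

definition generalized_derivation :: "('a::ring \<Rightarrow> 'a) \<Rightarrow> bool" where
  "generalized_derivation \<psi> \<longleftrightarrow>
     additive \<psi> \<and> (\<exists>d. derivation d \<and> (\<forall>x y. \<psi> (x * y) = \<psi> x * y + x * d y))"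

definition dependent_element :: "('a::ring \<Rightarrow> 'a) \<Rightarrow> 'a \<Rightarrow> bool" where
  "dependent_element T a \<longleftrightarrow> (\<forall>x. T x * a = a * x)"

end

theory Submission
  imports Defs
begin

text \<open>
  The first alternative always holds: an element \<open>a\<close> dependent on a generalized derivation \<open>\<psi>\<close>
  with associated derivation \<open>d\<close> is central. Expanding \<open>\<psi> (x * y) * a = a * x * y\<close> in two ways
  gives \<open>\<psi> x * [a, y] = x * d y * a\<close>. The right-hand side is left linear in \<open>x\<close>, so the
  failure \<open>\<psi> (z * x) - z * \<psi> x\<close> of \<open>\<psi>\<close> to be left linear annihilates every commutator
  \<open>[a, y]\<close> from the left. If \<open>a\<close> were not central, primeness would make \<open>\<psi>\<close> left linear,
  whence \<open>a * x * y = \<psi> (x * y) * a = x * \<psi> y * a = x * a * y\<close>. Thus \<open>[a, x] * R = 0\<close>,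
  which primeness turns into \<open>[a, x] = 0\<close> after all.
\<close>

text \<open>
  Replacing \<open>y\<close> by \<open>y * w\<close> and using that \<open>[a, \<cdot>]\<close> is a derivation gives \<open>f * y * [a, w] = 0\<close>
  for all \<open>y\<close>, which is the hypothesis of primeness for \<open>f\<close> and a nonzero \<open>[a, w]\<close>.
\<close>

lemma left_annihilator_of_commutators_trivial:
  fixes a f :: "'a::prime_ring"
  assumes annihilates: "\<And>y. f * (a * y - y * a) = 0"
    and noncentral: "a \<notin> ring_center"
  shows "f = 0"
proof -
  obtain w where w: "a * w - w * a \<noteq> 0"
    using noncentral by (auto simp: ring_center_def)
  have "f * y * (a * w - w * a) = 0" for y
  proof -
    have "f * (a * (y * w) - (y * w) * a)
        = f * (a * y - y * a) * w + f * y * (a * w - w * a)"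
      by (simp add: algebra_simps)
    then show ?thesis
      using annihilates[of y] annihilates[of "y * w"] by simp
  qed
  then show ?thesis
    using prime_ring w by blast
qed

lemma eq_zero_if_left_annihilator:
  fixes c :: "'a::prime_ring"
  assumes "\<And>y. c * y = 0"
  shows "c = 0"
  using prime_ring[of c c] assms by simp

lemma central_if_dependent_on_left_linear:
  fixes \<psi> :: "'a::prime_ring \<Rightarrow> 'a"
  assumes linear: "\<And>z x. \<psi> (z * x) = z * \<psi> x"
    and dependent: "dependent_element \<psi> a"
  shows "a \<in> ring_center"
proof -
  have "a * x - x * a = 0" for x
  proof (rule eq_zero_if_left_annihilator)
    fix y
    have "a * (x * y) = x * (a * y)"
      using dependent linear[of x y] unfolding dependent_element_def
      by (metis mult.assoc)
    then show "(a * x - x * a) * y = 0"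
      by (simp add: algebra_simps)
  qed
  then show ?thesis
    by (simp add: ring_center_def)
qed

theorem dependent_element_of_generalized_derivation_central:
  fixes \<psi> :: "'a::prime_ring \<Rightarrow> 'a"
  assumes "generalized_derivation \<psi>"
    and "dependent_element \<psi> a"
  shows "a \<in> ring_center"
proof (rule ccontr)
  assume noncentral: "a \<notin> ring_center"
  obtain d where \<psi>_mult: "\<And>x y. \<psi> (x * y) = \<psi> x * y + x * d y"
    using assms(1) unfolding generalized_derivation_def by blast
  have dep: "\<psi> x * a = a * x" for x
    using assms(2) by (simp add: dependent_element_def)
  have key: "\<psi> x * (a * y - y * a) = x * d y * a" for x y
  proof -
    have "\<psi> x * y * a + x * d y * a = \<psi> x * a * y"
      using dep[of "x * y"] dep[of x] \<psi>_mult[of x y]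
      by (simp add: algebra_simps)
    then show ?thesis
      by (simp add: algebra_simps)
  qed
  have "\<psi> (z * x) - z * \<psi> x = 0" for z x
  proof (rule left_annihilator_of_commutators_trivial[OF _ noncentral])
    fix y
    have "\<psi> (z * x) * (a * y - y * a) = z * (\<psi> x * (a * y - y * a))"
      by (simp only: key mult.assoc)
    then show "(\<psi> (z * x) - z * \<psi> x) * (a * y - y * a) = 0"
      by (simp only: left_diff_distrib mult.assoc diff_self)
  qed
  then have "a \<in> ring_center"
    using assms(2) by (intro central_if_dependent_on_left_linear) simp_all
  with noncentral show False ..
qed

theorem theorem2p2:
  fixes \<psi> :: "'a::prime_ring \<Rightarrow> 'a" and a :: 'a
  assumes "generalized_derivation \<psi>"
    and "dependent_element \<psi> a"
  shows "a \<in> ring_center \<or> (\<forall>x. \<psi> x = x)"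
  using dependent_element_of_generalized_derivation_central[OF assms] ..

end
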